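(* Let $n,m,k$ be integers with $m\ge 1$ and $1\le k<n$, and let $(p_{ij})\in\{0,1\}^{n\times m}$ be a matrix of voters' preference profiles. Consider the mixed-integer program in the variables $v\in\mathbb{R}$, $z=(z_{ij})\in\mathbb{R}^{n\times m}$, $x\in\{0,1\}^m$: $$\begin{aligned}\min\ & v\\ \text{s.t. } & z_{ij}\ge p_{ij}(1-x_j) && i=1,\dots,n,\ j=1,\dots,m,\\ & z_{ij}\ge (1-p_{ij})x_j && i=1,\dots,n,\ j=1,\dots,m,\\ & \sum_{j=1}^m\sum_{i\in S} z_{ij}\le v && \text{for all } S\subset\{1,\dots,n\},\ |S|=k,\\ & x\in\{0,1\}^m.\end{aligned}$$ Then an optimal solution of the $k$-sum approval voting problem can be obtained by solving this program: the program has an optimal solution, and for every optimal solution $(x,z,v)$ of it, the vector $x$ is an optimal solution of the $k$-sum approval voting problem.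
   Context: There are $n$ voters and $m$ candidates. The preference profile of voter $i$ is the vector $P_i=(p_{i1},\dots,p_{im})\in\{0,1\}^m$, with $p_{ij}=1$ if and only if voter $i$ approves candidate $j$. A committee is a vector $x\in\{0,1\}^m$ (no constraint on its size). The Hamming distance of voter $i$ to $x$ is $d_i(x)=\sum_{j=1}^m|p_{ij}-x_j|$. The $k$-sum approval voting problem is to find $x\in\{0,1\}^m$ minimizing the sum of the $k$ largest among the $n$ numbers $d_1(x),\dots,d_n(x)$ (counted with multiplicity). *)

theory Defs
  imports "HOL-Analysis.Analysis" "HOL-Library.Multiset"
begin

text \<open>
  Voters are the elements of the finite type \<open>'n\<close> and candidates those of the finite type \<open>'m\<close>,
  so that \<open>n = CARD('n)\<close> and \<open>m = CARD('m)\<close>; both are at least 1, types being nonempty.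
  In \<open>p :: real ^ 'm ^ 'n\<close>, row \<open>p $ i\<close> is the preference profile of voter \<open>i\<close>.
\<close>

definition binary_vec :: "real ^ 'm \<Rightarrow> bool" where
  "binary_vec x \<longleftrightarrow> (\<forall>j. x $ j \<in> {0, 1})"

definition hamming_dist :: "real ^ 'm \<Rightarrow> real ^ 'm \<Rightarrow> real" where
  "hamming_dist y x = (\<Sum>j\<in>UNIV. \<bar>y $ j - x $ j\<bar>)"

text \<open>
  The values of \<open>d\<close> are collected in a multiset, so repeated values are counted with
  multiplicity; the list is sorted increasingly before it is reversed.
\<close>

definition sum_k_largest :: "nat \<Rightarrow> ('n::finite \<Rightarrow> real) \<Rightarrow> real" where
  "sum_k_largest k d =
     sum_list (take k (rev (sorted_list_of_multiset (image_mset d (mset_set UNIV)))))"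

definition ksum_objective :: "nat \<Rightarrow> real ^ 'm ^ 'n \<Rightarrow> real ^ 'm \<Rightarrow> real" where
  "ksum_objective k p x = sum_k_largest k (\<lambda>i. hamming_dist (p $ i) x)"

definition ksum_voting_optimal :: "nat \<Rightarrow> real ^ 'm ^ 'n \<Rightarrow> real ^ 'm \<Rightarrow> bool" where
  "ksum_voting_optimal k p x \<longleftrightarrow> is_arg_min (ksum_objective k p) binary_vec x"

definition mip_feasible ::
  "nat \<Rightarrow> real ^ 'm ^ 'n \<Rightarrow> (real ^ 'm) \<times> (real ^ 'm ^ 'n) \<times> real \<Rightarrow> bool" where
  "mip_feasible k p = (\<lambda>(x, z, v).
     (\<forall>i j. z $ i $ j \<ge> p $ i $ j * (1 - x $ j)) \<and>
     (\<forall>i j. z $ i $ j \<ge> (1 - p $ i $ j) * x $ j) \<and>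
     (\<forall>S :: 'n set. card S = k \<longrightarrow> (\<Sum>j\<in>UNIV. \<Sum>i\<in>S. z $ i $ j) \<le> v) \<and>
     binary_vec x)"

definition mip_optimal ::
  "nat \<Rightarrow> real ^ 'm ^ 'n \<Rightarrow> (real ^ 'm) \<times> (real ^ 'm ^ 'n) \<times> real \<Rightarrow> bool" where
  "mip_optimal k p s \<longleftrightarrow> is_arg_min (\<lambda>(x, z, v). v) (mip_feasible k p) s"

end

theory Submission
  imports Defs
begin

text \<open>
  The sum of the \<open>k\<close> largest values of \<open>d\<close> is the maximum of \<open>\<Sum>i\<in>S. d i\<close> over the
  \<open>k\<close>-element sets \<open>S\<close>. For binary data the two constraints on \<open>z $ i $ j\<close> together say
  \<open>z $ i $ j \<ge> \<bar>p $ i $ j - x $ j\<bar>\<close>. Hence, for a fixed binary \<open>x\<close>, the smallest feasible \<open>v\<close>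
  is exactly the \<open>k\<close>-sum objective at \<open>x\<close>.
\<close>

lemma sum_le_if_all_le:
  fixes d :: "'a \<Rightarrow> 'b::{ordered_comm_monoid_add}"
  assumes "finite A" "finite B" "card A = card B" "\<And>a b. a \<in> A \<Longrightarrow> b \<in> B \<Longrightarrow> d a \<le> d b"
  shows "sum d A \<le> sum d B"
proof -
  \<comment> \<open>Any bijection serves, since the hypothesis compares every element of
    \<open>A\<close> with every element of \<open>B\<close>.\<close>
  obtain f where f: "bij_betw f A B"
    using finite_same_card_bij assms(1-3) by blast
  have "sum d A \<le> (\<Sum>a\<in>A. d (f a))"
    using assms(4) bij_betwE[OF f] by (intro sum_mono) auto
  then show ?thesis
    using sum.reindex_bij_betw[OF f, of d] by simp
qed

text \<open>Exchange argument: \<open>S \<inter> T\<close> contributes equally to both sums, and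
  what remains on either side has the same size because \<open>card S = card T\<close>.\<close>

lemma sum_le_sum_if_dominates_complement:
  fixes d :: "'a \<Rightarrow> 'b::{ordered_comm_monoid_add}"
  assumes "finite S" "finite T" "card S = card T"
    and "\<And>a b. a \<in> S - T \<Longrightarrow> b \<in> T \<Longrightarrow> d a \<le> d b"
  shows "sum d S \<le> sum d T"
proof -
  have "card (S - T) = card (T - S)"
    using assms(1-3) by (simp add: card_Diff_subset_Int Int_commute)
  then have "sum d (S - T) \<le> sum d (T - S)"
    using assms by (intro sum_le_if_all_le) auto
  then have "sum d (S - T) + sum d (S \<inter> T) \<le> sum d (T - S) + sum d (S \<inter> T)"
    by (rule add_right_mono)
  moreover have "sum d S = sum d (S - T) + sum d (S \<inter> T)"
    using sum.Int_Diff[OF assms(1), of d T] by (simp add: add.commute)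
  moreover have "sum d T = sum d (T - S) + sum d (S \<inter> T)"
    using sum.Int_Diff[OF assms(2), of d S] by (simp add: add.commute Int_commute)
  ultimately show ?thesis
    by simp
qed

lemma sum_k_largest_attained_max:
  fixes d :: "'n::finite \<Rightarrow> real"
  assumes "k \<le> CARD('n)"
  obtains T where "card T = k" "sum_k_largest k d = sum d T"
    "\<And>S. card S = k \<Longrightarrow> sum d S \<le> sum d T"
proof -
  obtain us :: "'n list" where us: "set us = UNIV" "distinct us"
    using finite_distinct_list[OF finite] by blast
  \<comment> \<open>Sorting voters rather than values lets the first \<open>k\<close> entries serve
    as the set \<open>T\<close>; ties are settled by the arbitrary enumeration
    \<open>us\<close>.\<close>
  define xs where "xs = rev (sort_key d us)"
  have xs: "set xs = UNIV" "distinct xs" "sorted (rev (map d xs))"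
    using us by (simp_all add: xs_def rev_map)
  then have mset: "mset_set UNIV = mset xs"
    using mset_set_set by metis
  \<comment> \<open>A multiset has only one increasing listing, and \<open>rev (map d xs)\<close> is
    such a listing.\<close>
  have "sorted_list_of_multiset (image_mset d (mset_set UNIV)) = rev (map d xs)"
    using xs(3) unfolding mset
    by (metis mset_map mset_rev sort_key_id_if_sorted sorted_list_of_multiset_mset sorted_sort_id)
  then have eq: "sum_k_largest k d = sum d (set (take k xs))"
    using xs(2) by (simp add: sum_k_largest_def take_map sum_list_distinct_conv_sum_set)
  \<comment> \<open>Here \<open>k \<le> CARD('n)\<close> keeps \<open>take\<close> from running
    short.\<close>
  have card: "card (set (take k xs)) = k"
    using assms xs distinct_card[of "take k xs"] distinct_card[of xs] by simp
  have dom: "d a \<le> d b" if "a \<in> set (drop k xs)" "b \<in> set (take k xs)" for a b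
  proof -
    \<comment> \<open>Reversal puts the dropped voters first, so sortedness of the append compares
      each of them with every voter taken.\<close>
    have "sorted (map d (rev (drop k xs)) @ map d (rev (take k xs)))"
      using xs(3) by (metis append_take_drop_id map_append rev_append rev_map)
    then show ?thesis
      using that by (auto simp: sorted_append)
  qed
  have "sum d S \<le> sum d (set (take k xs))" if "card S = k" for S
  proof (rule sum_le_sum_if_dominates_complement)
    fix a b assume "a \<in> S - set (take k xs)" "b \<in> set (take k xs)"
    moreover have "set xs = set (take k xs) \<union> set (drop k xs)"
      by (metis append_take_drop_id set_append)
    ultimately show "d a \<le> d b"
      using xs(1) dom by blast
  qed (use that card in auto)
  then show thesis
    using that eq card by blast
qed

text \<open>Bridge from the sorted list to the constraints of the program. From right to left,
  instantiate \<open>S\<close> with a maximizing set.\<close>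

lemma sum_k_largest_le_iff:
  fixes d :: "'n::finite \<Rightarrow> real"
  assumes "k \<le> CARD('n)"
  shows "sum_k_largest k d \<le> v \<longleftrightarrow> (\<forall>S. card S = k \<longrightarrow> sum d S \<le> v)"
  using sum_k_largest_attained_max[OF assms, of d] by (metis order_trans)

text \<open>Used to obtain a minimizing committee.\<close>

lemma finite_binary_vec: "finite {x :: real ^ 'm. binary_vec x}"
proof (rule finite_subset)
  show "{x :: real ^ 'm. binary_vec x} \<subseteq> vec_lambda ` (UNIV \<rightarrow>\<^sub>E {0, 1})"
  proof
    fix x :: "real ^ 'm" assume "x \<in> {x. binary_vec x}"
    then have "vec_nth x \<in> UNIV \<rightarrow>\<^sub>E {0, 1}"
      by (auto simp: binary_vec_def)
    then show "x \<in> vec_lambda ` (UNIV \<rightarrow>\<^sub>E {0, 1})"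
      by (metis image_eqI vec_nth_inverse)
  qed
qed (simp add: finite_PiE)

text \<open>One of the two products is 0 and the other is \<open>\<bar>a - b\<bar>\<close>, so their
  maximum is \<open>\<bar>a - b\<bar>\<close>.\<close>

lemma abs_diff_binary_le_iff:
  fixes a b z :: real
  assumes "a \<in> {0, 1}" "b \<in> {0, 1}"
  shows "\<bar>a - b\<bar> \<le> z \<longleftrightarrow> a * (1 - b) \<le> z \<and> (1 - a) * b \<le> z"
  using assms by auto

text \<open>Grouping the sums by voter makes each inner sum comparable with a Hamming
  distance.\<close>

lemma mip_feasible_iff:
  fixes p :: "real ^ 'm ^ 'n"
  assumes "\<And>i. binary_vec (p $ i)"
  shows "mip_feasible k p (x, z, v) \<longleftrightarrow> binary_vec x \<and>
    (\<forall>i j. \<bar>p $ i $ j - x $ j\<bar> \<le> z $ i $ j) \<and>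
    (\<forall>S. card S = k \<longrightarrow> (\<Sum>i\<in>S. \<Sum>j\<in>UNIV. z $ i $ j) \<le> v)"
proof (cases "binary_vec x")
  case True
  then have "\<bar>p $ i $ j - x $ j\<bar> \<le> z $ i $ j \<longleftrightarrow>
      p $ i $ j * (1 - x $ j) \<le> z $ i $ j \<and> (1 - p $ i $ j) * x $ j \<le> z $ i $ j" for i j
    using assms by (intro abs_diff_binary_le_iff) (auto simp: binary_vec_def)
  moreover have "(\<Sum>j\<in>UNIV. \<Sum>i\<in>S. z $ i $ j) = (\<Sum>i\<in>S. \<Sum>j\<in>UNIV. z $ i $ j)" for S
    by (rule sum.swap)
  ultimately show ?thesis
    unfolding mip_feasible_def by auto
qed (simp add: mip_feasible_def)

lemma ksum_objective_le_mip_value: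
  fixes p :: "real ^ 'm ^ 'n"
  assumes "k \<le> CARD('n)" "\<And>i. binary_vec (p $ i)" "mip_feasible k p (x, z, v)"
  shows "ksum_objective k p x \<le> v"
proof -
  have feas: "\<bar>p $ i $ j - x $ j\<bar> \<le> z $ i $ j"
      "card S = k \<Longrightarrow> (\<Sum>i\<in>S. \<Sum>j\<in>UNIV. z $ i $ j) \<le> v" for i j S
    using assms(3) mip_feasible_iff[OF assms(2)] by auto
  have "(\<Sum>i\<in>S. hamming_dist (p $ i) x) \<le> v" if "card S = k" for S
    using feas(2)[OF that] unfolding hamming_dist_def
    by (rule order_trans[rotated]) (intro sum_mono feas(1))
  then show ?thesis
    unfolding ksum_objective_def sum_k_largest_le_iff[OF assms(1)] by blast
qed

text \<open>With \<open>z\<close> as small as its constraints allow, row \<open>i\<close> sums to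
  the distance of voter \<open>i\<close>, so the bound of \<open>ksum_objective_le_mip_value\<close>
  is attained.\<close>

lemma mip_feasible_ksum_objective:
  fixes p :: "real ^ 'm ^ 'n"
  assumes "k \<le> CARD('n)" "\<And>i. binary_vec (p $ i)" "binary_vec x"
  shows "mip_feasible k p (x, \<chi> i j. \<bar>p $ i $ j - x $ j\<bar>, ksum_objective k p x)"
proof -
  have "\<forall>S. card S = k \<longrightarrow> (\<Sum>i\<in>S. hamming_dist (p $ i) x) \<le> ksum_objective k p x"
    unfolding ksum_objective_def sum_k_largest_le_iff[OF assms(1), symmetric] by simp
  then show ?thesis
    using assms(3) by (simp add: mip_feasible_iff[OF assms(2)] hamming_dist_def)
qed

theorem theorem1:
  fixes p :: "real ^ 'm ^ 'n" and k :: nat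
  assumes "1 \<le> k" and "k < CARD('n)"
    and "\<And>i. binary_vec (p $ i)"
  shows "(\<exists>x z v. mip_optimal k p (x, z, v)) \<and>
         (\<forall>x z v. mip_optimal k p (x, z, v) \<longrightarrow> ksum_voting_optimal k p x)"
proof (intro conjI allI impI)
  have k: "k \<le> CARD('n)"
    using assms(2) by simp
  note lower = ksum_objective_le_mip_value[OF k assms(3)]
  note feasible = mip_feasible_ksum_objective[OF k assms(3)]
  \<comment> \<open>The empty committee shows that the finite search space is nonempty, so a
    minimizer exists.\<close>
  have "binary_vec (0 :: real ^ 'm)"
    by (simp add: binary_vec_def)
  then obtain x where x: "is_arg_min (ksum_objective k p) binary_vec x"
    using ex_is_arg_min_if_finite[OF finite_binary_vec, of "ksum_objective k p"] by auto
  \<comment> \<open>The objective at \<open>y\<close> lies between the two sides.\<close>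
  have "ksum_objective k p x \<le> v" if "mip_feasible k p (y, z, v)" for y z v
  proof -
    have "binary_vec y"
      using that by (simp add: mip_feasible_def)
    then show ?thesis
      using x lower[OF that] by (force simp: is_arg_min_linorder)
  qed
  then have "mip_optimal k p (x, \<chi> i j. \<bar>p $ i $ j - x $ j\<bar>, ksum_objective k p x)"
    using x feasible by (auto simp: mip_optimal_def is_arg_min_linorder)
  then show "\<exists>x z v. mip_optimal k p (x, z, v)"
    by blast
  fix x z v assume "mip_optimal k p (x, z, v)"
  then have xzv: "mip_feasible k p (x, z, v)"
    and opt: "\<And>y w u. mip_feasible k p (y, w, u) \<Longrightarrow> v \<le> u"
    by (auto simp: mip_optimal_def is_arg_min_linorder)
  \<comment> \<open>Here \<open>v\<close> lies between the two sides: \<open>y\<close> extends to a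
    feasible point whose value is its objective, and \<open>v\<close> is the least value.\<close>
  have "ksum_objective k p x \<le> ksum_objective k p y" if "binary_vec y" for y
    using lower[OF xzv] opt[OF feasible[OF that]] by simp
  moreover have "binary_vec x"
    using xzv by (simp add: mip_feasible_def)
  ultimately show "ksum_voting_optimal k p x"
    by (simp add: ksum_voting_optimal_def is_arg_min_linorder)
qed

end
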